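(* Let $D$ be a skeletal directed acyclic graph. The two maps $\delta_\vee$ and $E_\vee$ are inverse bijections between the acyclic reorientations of $D$ and the non-crossing rope diagrams of $D$. Likewise, the two maps $\delta_\wedge$ and $E_\wedge$ are inverse bijections between the acyclic reorientations of $D$ and the non-crossing rope diagrams of $D$.
   Context: All directed graphs are finite and simple. A reorientation of a directed acyclic graph $D=(V,A)$ is a directed graph with the same underlying undirected graph, encoded by the set of arcs of $D$ that it reverses. $\mathcal{AR}_D$ is the poset of acyclic reorientations of $D$ ordered by inclusion of sets of reversed arcs. The transitive reduction of a directed acyclic graph is obtained by deleting all arcs whose endpoints are connected by a directed path of length at least $2$. A directed graph is a forest if its underlying undirected graph has no cycle. $D$ is vertebrate if the transitive reduction of every induced subgraph of $D$ is a forest; filled if for any directed path $\pi$ in $D$ whose endpoints are joined by an arc of $D$, all arcs joining any two vertices of $\pi$ belong to $D$; skeletal if vertebrate and filled. When $D$ is skeletal, $\mathcal{AR}_D$ is a lattice. The transitive support of an arc $(u,v)$ of $D$ is the set of vertices appearing along directed paths in $D$ from $u$ to $v$. A rope of $D$ is a quadruple $(u,v,\nabla,\Delta)$ where $(u,v)\in A$ and $\nabla\sqcup\Delta$ is a partition of the transitive support of $(u,v)$ minus $\{u,v\}$. Two ropes $(u,v,\nabla,\Delta)$ and $(u',v',\nabla',\Delta')$ are crossing if there are distinct vertices $w\ne w'$ such that $w\in(\nabla\cup\{u,v\})\cap(\Delta'\cup\{u',v'\})$ and $w'\in(\Delta\cup\{u,v\})\cap(\nabla'\cup\{u',v'\})$.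 A non-crossing rope diagram is a set of ropes of $D$ any two distinct of which are non-crossing. For an acyclic reorientation $E$ of $D$ and an arc $(u,v)$ of $D$, let $\nabla_{u,v}^E=\{w\in V : (u,w)\in D\setminus E,\ (w,v)\in D\cap E\}$, $\Delta_{u,v}^E=\{w\in V : (u,w)\in D\cap E,\ (w,v)\in D\setminus E\}$, and $\rho_{u,v}^E=(u,v,\nabla_{u,v}^E,\Delta_{u,v}^E)$. Let $\delta_\vee(E)$ (resp. $\delta_\wedge(E)$) be the set of all $\rho_{u,v}^E$ for the arcs $(u,v)$ of $D$ that are reversed (resp. not reversed) in the transitive reduction of $E$, i.e. such that $(v,u)$ (resp. $(u,v)$) is an arc of the transitive reduction of $E$. For a rope $\rho=(u,v,\nabla,\Delta)$, let $I_\vee(\rho)$ be the acyclic reorientation of $D$ where an arc $(w,w')$ of $D$ is reversed if and only if $w\in\Delta\cup\{u\}$ and $w'\in\nabla\cup\{v\}$; let $I_\wedge(\rho)$ be the acyclic reorientation of $D$ where an arc $(w,w')$ of $D$ is not reversed if and only if $w\in\nabla\cup\{u\}$ and $w'\in\Delta\cup\{v\}$. For a non-crossing rope diagram $\delta$, let $E_\vee(\delta)=\bigvee_{\rho\in\delta}I_\vee(\rho)$ and $E_\wedge(\delta)=\bigwedge_{\rho\in\delta}I_\wedge(\rho)$, computed in $\mathcal{AR}_D$. *)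

theory Defs
  imports "HOL-Algebra.Lattice"
begin

text \<open>
  A finite simple directed graph is given by its vertex set \<open>V\<close> and its arc relation \<open>A\<close>;
  acyclicity also rules out loops and pairs of opposite arcs.
\<close>

definition dag :: "'a set \<Rightarrow> 'a rel \<Rightarrow> bool" where
  "dag V A \<longleftrightarrow> finite V \<and> A \<subseteq> V \<times> V \<and> acyclic A"

text \<open>Paths are lists of vertices, so a path of length \<open>k\<close> is a list of length \<open>k + 1\<close>.\<close>

definition dipath :: "'a rel \<Rightarrow> 'a list \<Rightarrow> bool" where
  "dipath A p \<longleftrightarrow> p \<noteq> [] \<and> distinct p \<and> successively (\<lambda>x y. (x, y) \<in> A) p"

definition transitive_reduction :: "'a rel \<Rightarrow> 'a rel" where
  "transitive_reduction A =
    {(u, v) \<in> A. \<not> (\<exists>p. dipath A p \<and> hd p = u \<and> last p = v \<and> length p \<ge> 3)}"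

definition undirected_cycle :: "'a rel \<Rightarrow> 'a list \<Rightarrow> bool" where
  "undirected_cycle A c \<longleftrightarrow>
    length c \<ge> 3 \<and> distinct c \<and>
    successively (\<lambda>x y. (x, y) \<in> A \<union> A\<inverse>) c \<and> (last c, hd c) \<in> A \<union> A\<inverse>"

definition forest :: "'a rel \<Rightarrow> bool" where
  "forest A \<longleftrightarrow> \<not> (\<exists>c. undirected_cycle A c)"

definition vertebrate :: "'a set \<Rightarrow> 'a rel \<Rightarrow> bool" where
  "vertebrate V A \<longleftrightarrow> (\<forall>U \<subseteq> V. forest (transitive_reduction (A \<inter> U \<times> U)))"

text \<open>In an acyclic graph, any arc between two vertices of a path points forward along it.\<close>

definition filled :: "'a rel \<Rightarrow> bool" where
  "filled A \<longleftrightarrow>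
    (\<forall>p. dipath A p \<and> (hd p, last p) \<in> A \<longrightarrow> sorted_wrt (\<lambda>x y. (x, y) \<in> A) p)"

definition skeletal :: "'a set \<Rightarrow> 'a rel \<Rightarrow> bool" where
  "skeletal V A \<longleftrightarrow> vertebrate V A \<and> filled A"

text \<open>
  A reorientation is encoded by the set \<open>E \<subseteq> A\<close> of arcs it reverses; \<open>reorient A E\<close> is the
  reoriented graph itself.
\<close>

definition reorient :: "'a rel \<Rightarrow> 'a rel \<Rightarrow> 'a rel" where
  "reorient A E = (A - E) \<union> E\<inverse>"

definition acyclic_reorientations :: "'a rel \<Rightarrow> 'a rel set" where
  "acyclic_reorientations A = {E. E \<subseteq> A \<and> acyclic (reorient A E)}"

definition AR_poset :: "'a rel \<Rightarrow> 'a rel gorder" where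
  "AR_poset A = \<lparr>carrier = acyclic_reorientations A, eq = (=), le = (\<subseteq>)\<rparr>"

definition transitive_support :: "'a rel \<Rightarrow> 'a \<Rightarrow> 'a \<Rightarrow> 'a set" where
  "transitive_support A u v = {w. \<exists>p. dipath A p \<and> hd p = u \<and> last p = v \<and> w \<in> set p}"

text \<open>In a rope \<open>(u, v, N, T)\<close>, \<open>N\<close> stands for \<open>\<nabla>\<close> and \<open>T\<close> for \<open>\<Delta>\<close>.\<close>

type_synonym 'a rope = "'a \<times> 'a \<times> 'a set \<times> 'a set"

definition ropes :: "'a rel \<Rightarrow> 'a rope set" where
  "ropes A = {(u, v, N, T). (u, v) \<in> A \<and>
    N \<union> T = transitive_support A u v - {u, v} \<and> N \<inter> T = {}}"

fun crossing :: "'a rope \<Rightarrow> 'a rope \<Rightarrow> bool" where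
  "crossing (u, v, N, T) (u', v', N', T') \<longleftrightarrow>
    (\<exists>w w'. w \<noteq> w' \<and>
      w \<in> (N \<union> {u, v}) \<inter> (T' \<union> {u', v'}) \<and>
      w' \<in> (T \<union> {u, v}) \<inter> (N' \<union> {u', v'}))"

definition noncrossing_diagrams :: "'a rel \<Rightarrow> 'a rope set set" where
  "noncrossing_diagrams A =
    {R. R \<subseteq> ropes A \<and> (\<forall>r \<in> R. \<forall>s \<in> R. r \<noteq> s \<longrightarrow> \<not> crossing r s)}"

text \<open>
  In \<open>nabla_set\<close> and \<open>delta_set\<close>, intersection with and difference from the reorientation refer
  to the reoriented graph: \<open>A - reorient A E\<close> consists of the reversed arcs of \<open>A\<close> and
  \<open>A \<inter> reorient A E\<close> of the arcs that are not reversed.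
\<close>

definition nabla_set :: "'a set \<Rightarrow> 'a rel \<Rightarrow> 'a rel \<Rightarrow> 'a \<Rightarrow> 'a \<Rightarrow> 'a set" where
  "nabla_set V A E u v =
    {w \<in> V. (u, w) \<in> A - reorient A E \<and> (w, v) \<in> A \<inter> reorient A E}"

definition delta_set :: "'a set \<Rightarrow> 'a rel \<Rightarrow> 'a rel \<Rightarrow> 'a \<Rightarrow> 'a \<Rightarrow> 'a set" where
  "delta_set V A E u v =
    {w \<in> V. (u, w) \<in> A \<inter> reorient A E \<and> (w, v) \<in> A - reorient A E}"

definition rope_of :: "'a set \<Rightarrow> 'a rel \<Rightarrow> 'a rel \<Rightarrow> 'a \<Rightarrow> 'a \<Rightarrow> 'a rope" where
  "rope_of V A E u v = (u, v, nabla_set V A E u v, delta_set V A E u v)"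

definition delta_join :: "'a set \<Rightarrow> 'a rel \<Rightarrow> 'a rel \<Rightarrow> 'a rope set" where
  "delta_join V A E =
    {rope_of V A E u v | u v. (u, v) \<in> A \<and> (v, u) \<in> transitive_reduction (reorient A E)}"

definition delta_meet :: "'a set \<Rightarrow> 'a rel \<Rightarrow> 'a rel \<Rightarrow> 'a rope set" where
  "delta_meet V A E =
    {rope_of V A E u v | u v. (u, v) \<in> A \<and> (u, v) \<in> transitive_reduction (reorient A E)}"

fun I_join :: "'a rel \<Rightarrow> 'a rope \<Rightarrow> 'a rel" where
  "I_join A (u, v, N, T) = {(w, w') \<in> A. w \<in> T \<union> {u} \<and> w' \<in> N \<union> {v}}"

fun I_meet :: "'a rel \<Rightarrow> 'a rope \<Rightarrow> 'a rel" where
  "I_meet A (u, v, N, T) = {(w, w') \<in> A. \<not> (w \<in> N \<union> {u} \<and> w' \<in> T \<union> {v})}"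

definition E_join :: "'a rel \<Rightarrow> 'a rope set \<Rightarrow> 'a rel" where
  "E_join A R = \<Squnion>\<^bsub>AR_poset A\<^esub> (I_join A ` R)"

definition E_meet :: "'a rel \<Rightarrow> 'a rope set \<Rightarrow> 'a rel" where
  "E_meet A R = \<Sqinter>\<^bsub>AR_poset A\<^esub> (I_meet A ` R)"

end

theory Submission
  imports Defs
begin

text \<open>
  Filledness and vertebracy make the transitive support of every arc a chain of pairwise adjacent
  vertices, and an orientation of a skeletal graph acyclic as soon as it has no directed triangle.
  Hence a set of arcs is an acyclic reorientation iff it and its complement are closed under
  triangles, and the join of acyclic reorientations consists of the arcs in the transitive closure
  of their union. A reorientation \<open>E\<close> is recovered from \<open>\<delta>\<^sub>\<or>(E)\<close> because \<open>E_join\<close> of it lies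
  below \<open>E\<close> and contains every reversed arc of the transitive reduction of \<open>E\<close>. Conversely, for a
  non-crossing diagram and one of its ropes \<open>(u, v, \<nabla>, \<Delta>)\<close>, an arc of some \<open>I_join\<close> leading from
  \<open>\<nabla> \<union> {u}\<close> to \<open>\<Delta> \<union> {v}\<close> would produce a crossing unless it is \<open>(u, v)\<close> itself, so the
  transitive closure creates no relation that spoils this rope. The statement for meets follows by
  complementing reorientations and exchanging \<open>\<nabla>\<close> and \<open>\<Delta>\<close>.
\<close>

section \<open>Walks\<close>

lemma walk_sorted_trancl:
  assumes "successively (\<lambda>x y. (x, y) \<in> G) p"
  shows "sorted_wrt (\<lambda>x y. (x, y) \<in> G\<^sup>+) p"
proof -
  have "successively (\<lambda>x y. (x, y) \<in> G\<^sup>+) p"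
    by (rule successively_mono[OF assms]) auto
  moreover have "transp (\<lambda>x y. (x, y) \<in> G\<^sup>+)"
    by (auto intro: transpI trancl_trans)
  ultimately show ?thesis
    by (simp add: successively_conv_sorted_wrt)
qed

lemma trancl_imp_walk:
  assumes "(x, y) \<in> G\<^sup>+"
  shows "\<exists>p. successively (\<lambda>x y. (x, y) \<in> G) (x # p @ [y])"
  using assms
proof (induction rule: converse_trancl_induct)
  case (base x)
  then have "successively (\<lambda>x y. (x, y) \<in> G) (x # [] @ [y])" by simp
  then show ?case by blast
next
  case (step x z)
  then obtain p where "successively (\<lambda>x y. (x, y) \<in> G) (z # p @ [y])" by blast
  with step have "successively (\<lambda>x y. (x, y) \<in> G) (x # (z # p) @ [y])" by simp
  then show ?case by blast
qed

lemma sorted_wrt_trancl_distinct: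
  assumes "acyclic G" "sorted_wrt (\<lambda>x y. (x, y) \<in> G\<^sup>+) p"
  shows "distinct p"
  using assms(2,1) by (induction p) (auto simp: acyclic_def)

lemma dipath_acyclic_iff:
  assumes "acyclic G"
  shows "dipath G p \<longleftrightarrow> p \<noteq> [] \<and> successively (\<lambda>x y. (x, y) \<in> G) p"
  using walk_sorted_trancl sorted_wrt_trancl_distinct[OF assms] by (auto simp: dipath_def)

lemma rtrancl_crossing_step:
  assumes "(x, y) \<in> S\<^sup>*" "P x" "\<not> P y"
  shows "\<exists>a b. (x, a) \<in> S\<^sup>* \<and> (a, b) \<in> S \<and> (b, y) \<in> S\<^sup>* \<and> P a \<and> \<not> P b"
  using assms
proof (induction rule: converse_rtrancl_induct)
  case base
  then show ?case by blast
next
  case (step x z)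
  then show ?case
    by (cases "P z") (blast intro: converse_rtrancl_into_rtrancl)+
qed

lemma acyclic_rtrancl_antisym:
  assumes "acyclic G" "(x, y) \<in> G\<^sup>*" "(y, x) \<in> G\<^sup>*"
  shows "x = y"
  using assms by (metis acyclic_def rtranclD trancl_trans)

lemma acyclic_asym: "acyclic G \<Longrightarrow> (x, y) \<in> G \<Longrightarrow> (y, x) \<notin> G"
  by (meson acyclic_def trancl.intros)

lemma acyclic_irrefl: "acyclic G \<Longrightarrow> (x, x) \<notin> G"
  by (meson acyclic_def trancl.intros)

lemma acyclic_no_triangle:
  assumes "acyclic G" "(x, y) \<in> G" "(y, z) \<in> G"
  shows "(z, x) \<notin> G"
proof
  assume "(z, x) \<in> G"
  with assms have "(x, x) \<in> G\<^sup>+"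
    by (blast intro: trancl_into_trancl r_into_trancl)
  with assms show False by (auto simp: acyclic_def)
qed

section \<open>Shortest closed walks and their chords\<close>

definition closed_walk :: "'a rel \<Rightarrow> 'a list \<Rightarrow> bool" where
  "closed_walk G c \<longleftrightarrow> c \<noteq> [] \<and> successively (\<lambda>x y. (x, y) \<in> G) c \<and> (last c, hd c) \<in> G"

lemma closed_walk_nth:
  "closed_walk G c \<longleftrightarrow> c \<noteq> [] \<and> (\<forall>i. Suc i < length c \<longrightarrow> (c ! i, c ! Suc i) \<in> G) \<and>
    (c ! (length c - 1), c ! 0) \<in> G"
  by (auto simp: closed_walk_def successively_conv_nth last_conv_nth hd_conv_nth)

lemma not_acyclic_closed_walk:
  assumes "\<not> acyclic G"
  obtains c where "closed_walk G c" "\<And>d. closed_walk G d \<Longrightarrow> length c \<le> length d"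
proof -
  from assms obtain x where "(x, x) \<in> G\<^sup>+" by (auto simp: acyclic_def)
  then obtain y where "(x, y) \<in> G\<^sup>*" "(y, x) \<in> G" by (meson tranclD2)
  have "\<exists>c. closed_walk G c"
  proof (cases "x = y")
    case True
    with \<open>(y, x) \<in> G\<close> have "closed_walk G [x]" by (simp add: closed_walk_def)
    then show ?thesis ..
  next
    case False
    with \<open>(x, y) \<in> G\<^sup>*\<close> have "(x, y) \<in> G\<^sup>+" by (simp add: rtrancl_eq_or_trancl)
    from trancl_imp_walk[OF this]
    obtain p where "successively (\<lambda>x y. (x, y) \<in> G) (x # p @ [y])" ..
    with \<open>(y, x) \<in> G\<close> have "closed_walk G (x # p @ [y])" by (simp add: closed_walk_def)
    then show ?thesis ..
  qed
  then obtain c where "closed_walk G c" "\<forall>d. closed_walk G d \<longrightarrow> length c \<le> length d"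
    using exists_least_iff[of "\<lambda>n. \<exists>c. closed_walk G c \<and> length c = n"]
    by (metis linorder_not_le)
  with that show thesis by blast
qed

locale shortest_closed_walk =
  fixes G :: "'a rel" and c :: "'a list"
  assumes walk: "closed_walk G c"
    and shortest: "closed_walk G d \<Longrightarrow> length c \<le> length d"
begin

text \<open>The chord closes the segment from position \<open>i\<close> to position \<open>j\<close>
  into a closed walk; by minimality this is all of \<open>c\<close>.\<close>

lemma back_chord:
  assumes "i \<le> j" "j < length c" "(c ! j, c ! i) \<in> G"
  shows "i = 0 \<and> j = length c - 1"
proof -
  let ?d = "take (Suc j - i) (drop i c)"
  have "length ?d = Suc j - i" using assms by auto
  then have "closed_walk G ?d"
    using walk assms unfolding closed_walk_nth by (auto simp del: length_take length_drop)
  from shortest[OF this] assms show ?thesis by auto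
qed

text \<open>Following the chord omits the vertices strictly between positions \<open>i\<close> and
  \<open>j\<close>; minimality leaves none to omit.\<close>

lemma forward_chord:
  assumes "i < j" "j < length c" "(c ! i, c ! j) \<in> G"
  shows "j = Suc i"
proof -
  let ?d = "take (Suc i) c @ drop j c"
  have "successively (\<lambda>x y. (x, y) \<in> G) (take (Suc i) c)" "successively (\<lambda>x y. (x, y) \<in> G) (drop j c)"
    using walk assms by (auto simp: closed_walk_nth successively_conv_nth)
  moreover have "last (take (Suc i) c) = c ! i" "hd (drop j c) = c ! j"
    using assms by (auto simp: take_Suc_conv_app_nth hd_drop_conv_nth)
  ultimately have "successively (\<lambda>x y. (x, y) \<in> G) ?d"
    using assms by (simp add: successively_append_iff)
  then have "closed_walk G ?d"
    using walk assms by (auto simp: closed_walk_def)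
  from shortest[OF this] assms show ?thesis by auto
qed

lemma distinct: "distinct c"
proof (rule ccontr)
  assume "\<not> distinct c"
  then obtain i j where ij: "i < j" "j < length c" "c ! i = c ! j"
    by (metis distinct_conv_nth linorder_less_linear)
  have step: "(c ! k, c ! Suc k) \<in> G" if "Suc k < length c" for k
    using walk that by (auto simp: closed_walk_nth)
  \<comment> \<open>Because \<open>c ! i = c ! j\<close>, the arc into position \<open>j\<close> is
    a back chord to position \<open>i\<close>. It must then start at the last position, which leaves
    no room for \<open>j\<close>.\<close>
  have "(c ! (j - 1), c ! i) \<in> G"
    using step[of "j - 1"] ij by simp
  then have "i = 0 \<and> j - 1 = length c - 1"
    using ij by (intro back_chord) auto
  with ij show False by linarith
qed

text \<open>Only cyclically consecutive vertices of the walk are adjacent, so it has length three.\<close>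

lemma triangle:
  assumes "x \<in> set c" "y \<in> set c" "z \<in> set c"
    and adj: "(x, y) \<in> G \<union> G\<inverse>" "(y, z) \<in> G \<union> G\<inverse>" "(x, z) \<in> G \<union> G\<inverse>"
    and neq: "x \<noteq> y" "y \<noteq> z" "x \<noteq> z"
  shows "\<exists>x y z. (x, y) \<in> G \<and> (y, z) \<in> G \<and> (z, x) \<in> G"
proof -
  have sorted: ?thesis
    if "i < j" "j < k" "k < length c" and "(c ! i, c ! j) \<in> G \<union> G\<inverse>"
      "(c ! j, c ! k) \<in> G \<union> G\<inverse>" "(c ! i, c ! k) \<in> G \<union> G\<inverse>" for i j k
  proof -
    \<comment> \<open>With \<open>j\<close> in between, the chord on \<open>i\<close> and
      \<open>k\<close> cannot point forward. The other two cannot point backward, as only the last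
      position has an arc back to an earlier one, namely the first.\<close>
    have "(c ! k, c ! i) \<in> G"
      using that forward_chord[of i k] by auto
    moreover have "(c ! i, c ! j) \<in> G"
      using that back_chord[of i j] by auto
    moreover have "(c ! j, c ! k) \<in> G"
      using that back_chord[of j k] by auto
    ultimately show ?thesis by blast
  qed
  from assms obtain i j k where idx: "x = c ! i" "y = c ! j" "z = c ! k"
    "i < length c" "j < length c" "k < length c"
    by (metis in_set_conv_nth)
  with neq have "i \<noteq> j" "j \<noteq> k" "i \<noteq> k" by auto
  then consider "i < j" "j < k" | "i < k" "k < j" | "j < i" "i < k" | "j < k" "k < i"
    | "k < i" "i < j" | "k < j" "j < i"
    by linarith
  then show ?thesis
  proof cases
    case 1 then show ?thesis using sorted[of i j k] idx adj by auto
  next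
    case 2 then show ?thesis using sorted[of i k j] idx adj by auto
  next
    case 3 then show ?thesis using sorted[of j i k] idx adj by auto
  next
    case 4 then show ?thesis using sorted[of j k i] idx adj by auto
  next
    case 5 then show ?thesis using sorted[of k i j] idx adj by auto
  next
    case 6 then show ?thesis using sorted[of k j i] idx adj by auto
  qed
qed

end

section \<open>Acyclic orientations of skeletal graphs\<close>

text \<open>Stated for an arbitrary \<open>G\<close>, not only for \<open>reorient A E\<close>, so
  that a single arc of \<open>G\<close> may be flipped later.\<close>

definition orientation :: "'a rel \<Rightarrow> 'a rel \<Rightarrow> bool" where
  "orientation A G \<longleftrightarrow> G \<union> G\<inverse> = A \<union> A\<inverse> \<and> G \<inter> G\<inverse> = {}"

text \<open>Transitivity as far as \<open>A\<close> allows it. When \<open>A\<close> is a transitive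
  tournament, the subsets \<open>S\<close> of \<open>A\<close> with both \<open>S\<close> and
  \<open>A - S\<close> closed are the inversion sets of permutations.\<close>

definition arc_closed :: "'a rel \<Rightarrow> 'a rel \<Rightarrow> bool" where
  "arc_closed A S \<longleftrightarrow> (\<forall>x y z. (x, y) \<in> S \<and> (y, z) \<in> S \<and> (x, z) \<in> A \<longrightarrow> (x, z) \<in> S)"

lemma arc_closedD:
  "arc_closed A S \<Longrightarrow> (x, y) \<in> S \<Longrightarrow> (y, z) \<in> S \<Longrightarrow> (x, z) \<in> A \<Longrightarrow> (x, z) \<in> S"
  unfolding arc_closed_def by blast

locale skeletal_dag =
  fixes V :: "'a set" and A :: "'a rel"
  assumes dag: "dag V A" and skeletal: "skeletal V A"
begin

lemma acyclic: "acyclic A" and finite_V: "finite V" and arcs_V: "A \<subseteq> V \<times> V"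
  using dag by (auto simp: dag_def)

lemmas asym = acyclic_asym[OF acyclic]
lemmas irrefl = acyclic_irrefl[OF acyclic]

text \<open>The two walks concatenate to a path whose ends are joined by an arc, so filledness
  applies. Most later uses of filledness go through this fact.\<close>

lemma sandwich:
  assumes "(x, y) \<in> A\<^sup>+" "(y, z) \<in> A\<^sup>+" "(x, z) \<in> A"
  shows "(x, y) \<in> A" "(y, z) \<in> A"
proof -
  from trancl_imp_walk[OF assms(1)]
  obtain p where "successively (\<lambda>x y. (x, y) \<in> A) (x # p @ [y])" ..
  moreover from trancl_imp_walk[OF assms(2)]
  obtain q where "successively (\<lambda>x y. (x, y) \<in> A) (y # q @ [z])" ..
  ultimately have "successively (\<lambda>x y. (x, y) \<in> A) ((x # p) @ y # q @ [z])"
    using successively_append_iff[of _ "x # p" "y # q @ [z]"]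
      successively_append_iff[of _ "x # p" "[y]"] by simp
  then have "dipath A ((x # p) @ y # q @ [z])"
    using dipath_acyclic_iff[OF acyclic] by blast
  moreover have "hd ((x # p) @ y # q @ [z]) = x" "last ((x # p) @ y # q @ [z]) = z"
    by simp_all
  ultimately have "sorted_wrt (\<lambda>x y. (x, y) \<in> A) ((x # p) @ y # q @ [z])"
    using skeletal assms(3) unfolding skeletal_def filled_def by metis
  then show "(x, y) \<in> A" "(y, z) \<in> A"
    by (auto simp: sorted_wrt_append)
qed

lemma not_transitive_reduction_induced:
  assumes "(x, y) \<in> A" "x \<in> U" "y \<in> U" "(x, y) \<notin> transitive_reduction (A \<inter> U \<times> U)"
  obtains m where "m \<in> U" "(x, m) \<in> A" "(m, y) \<in> A"
proof -
  from assms obtain p where p: "dipath (A \<inter> U \<times> U) p" "hd p = x" "last p = y" "length p \<ge> 3"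
    by (auto simp: transitive_reduction_def)
  then obtain m q where pq: "p = x # m # q" "q \<noteq> []"
    by (cases p; cases "tl p"; cases "tl (tl p)") auto
  have "dipath A p"
    using p(1) by (auto simp: dipath_def elim: successively_mono)
  then have "sorted_wrt (\<lambda>x y. (x, y) \<in> A) p"
    using skeletal assms(1) p unfolding skeletal_def filled_def by force
  moreover have "m \<in> U"
    using p(1) pq by (auto simp: dipath_def)
  moreover have "y \<in> set q" using pq p(3) by auto
  ultimately show thesis using that pq by auto
qed

text \<open>If \<open>y\<close> and \<open>w\<close> were distinct and not adjacent, the four arcs
  at them would survive in the transitive reduction of the graph induced on \<open>x\<close>,
  \<open>y\<close>, \<open>w\<close>, \<open>z\<close> and form a 4-cycle.\<close>

lemma support_chain:
  assumes "(x, z) \<in> A" "(x, y) \<in> A" "(y, z) \<in> A" "(x, w) \<in> A" "(w, z) \<in> A"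
  shows "y = w \<or> (y, w) \<in> A \<or> (w, y) \<in> A"
proof (rule ccontr)
  assume neg: "\<not> ?thesis"
  let ?U = "{x, y, w, z}"
  let ?R = "transitive_reduction (A \<inter> ?U \<times> ?U)"
  have "?U \<subseteq> V" using assms arcs_V by auto
  then have "forest ?R"
    using skeletal unfolding skeletal_def vertebrate_def by blast
  moreover have red: "(a, b) \<in> ?R"
    if "(a, b) \<in> A" "a \<in> ?U" "b \<in> ?U" "\<And>m. m \<in> ?U \<Longrightarrow> (a, m) \<in> A \<Longrightarrow> (m, b) \<notin> A" for a b
    using not_transitive_reduction_induced[OF that(1-3)] that(4) by blast
  have "(x, y) \<in> ?R" "(x, w) \<in> ?R" "(y, z) \<in> ?R" "(w, z) \<in> ?R"
    using assms neg by (intro red; auto dest: asym simp: irrefl)+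
  moreover have "distinct [x, y, z, w]"
    using assms neg by (auto simp: irrefl)
  ultimately have "undirected_cycle ?R [x, y, z, w]"
    unfolding undirected_cycle_def by simp
  with \<open>forest ?R\<close> show False unfolding forest_def by blast
qed

text \<open>A shortest directed cycle is chordless, so by vertebracy one of its arcs is transitively
  redundant among its vertices, and by filledness this yields a triangle.\<close>

lemma triangle_free_orientation_acyclic:
  assumes ori: "orientation A G"
    and tri: "\<And>x y z. (x, y) \<in> G \<Longrightarrow> (y, z) \<in> G \<Longrightarrow> (z, x) \<notin> G"
  shows "acyclic G"
proof (rule ccontr)
  assume "\<not> acyclic G"
  then obtain c where c: "closed_walk G c" "\<And>d. closed_walk G d \<Longrightarrow> length c \<le> length d"
    by (rule not_acyclic_closed_walk) blast
  then interpret shortest_closed_walk G c by unfold_locales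
  let ?U = "set c"
  let ?R = "transitive_reduction (A \<inter> ?U \<times> ?U)"
  have GA: "(x, y) \<in> G \<Longrightarrow> (x, y) \<in> A \<union> A\<inverse>" and AG: "(x, y) \<in> A \<Longrightarrow> (x, y) \<in> G \<union> G\<inverse>" for x y
    using ori unfolding orientation_def by blast+
  have step: "(x, y) \<in> ?R \<union> ?R\<inverse>" if "(x, y) \<in> G" "x \<in> ?U" "y \<in> ?U" for x y
  proof (rule ccontr)
    assume no: "\<not> ?thesis"
    have "False" if "(a, b) \<in> A" "a \<in> ?U" "b \<in> ?U" "(a, b) \<notin> ?R" for a b
    proof -
      from that obtain m where "m \<in> ?U" "(a, m) \<in> A" "(m, b) \<in> A"
        by (rule not_transitive_reduction_induced)
      then have "\<exists>x y z. (x, y) \<in> G \<and> (y, z) \<in> G \<and> (z, x) \<in> G"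
        using that AG irrefl by (intro triangle[of a m b]) auto
      with tri show False by blast
    qed
    with no GA[OF that(1)] that show False by blast
  qed
  have len: "length c \<ge> 3"
  proof (rule ccontr)
    assume "\<not> ?thesis"
    then consider "c = []" | a where "c = [a]" | a b where "c = [a, b]"
      by (cases c; cases "tl c"; cases "tl (tl c)") auto
    then show False
      using c(1) ori by cases (auto simp: closed_walk_def orientation_def)
  qed
  have "?U \<subseteq> V"
  proof
    fix x assume "x \<in> ?U"
    then obtain i where i: "i < length c" "x = c ! i" by (metis in_set_conv_nth)
    have "\<exists>y. (x, y) \<in> G"
    proof (cases "Suc i < length c")
      case True
      then show ?thesis using c(1) i by (auto simp: closed_walk_nth)
    next
      case False
      then have "i = length c - 1" using i by auto
      then show ?thesis using c(1) i by (auto simp: closed_walk_nth)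
    qed
    then show "x \<in> V" using GA arcs_V by blast
  qed
  then have "forest ?R"
    using skeletal unfolding skeletal_def vertebrate_def by blast
  moreover have "undirected_cycle ?R c"
    unfolding undirected_cycle_def
  proof (intro conjI)
    show "successively (\<lambda>x y. (x, y) \<in> ?R \<union> ?R\<inverse>) c"
      using c(1) step by (simp add: closed_walk_nth successively_conv_nth del: Un_iff)
    show "(last c, hd c) \<in> ?R \<union> ?R\<inverse>"
      using c(1) by (intro step) (auto simp: closed_walk_def)
  qed (use len distinct in auto)
  ultimately show False by (auto simp: forest_def)
qed

text \<open>An arc with no bypass of length two can be flipped without creating a directed triangle,
  so the flipped graph \<open>?H\<close> is acyclic. A longer bypass would survive in
  \<open>?H\<close> and close a cycle with the flipped arc.\<close>

lemma transitive_reduction_orientation_iff: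
  assumes ori: "orientation A G" and acyc: "acyclic G"
  shows "(x, y) \<in> transitive_reduction G \<longleftrightarrow> (x, y) \<in> G \<and> (\<nexists>z. (x, z) \<in> G \<and> (z, y) \<in> G)"
proof (intro iffI conjI notI)
  assume R: "(x, y) \<in> transitive_reduction G"
  then show "(x, y) \<in> G" by (auto simp: transitive_reduction_def)
  assume "\<exists>z. (x, z) \<in> G \<and> (z, y) \<in> G"
  then obtain z where "(x, z) \<in> G" "(z, y) \<in> G" by blast
  then have "dipath G [x, z, y]"
    by (simp add: dipath_acyclic_iff[OF acyc])
  moreover have "hd [x, z, y] = x" "last [x, z, y] = y" "length [x, z, y] \<ge> 3" by simp_all
  ultimately show False using R unfolding transitive_reduction_def by blast
next
  assume *: "(x, y) \<in> G \<and> (\<nexists>z. (x, z) \<in> G \<and> (z, y) \<in> G)"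
  let ?H = "insert (y, x) (G - {(x, y)})"
  have "orientation A ?H"
    using ori * unfolding orientation_def set_eq_iff by auto
  moreover have "(c, a) \<notin> ?H" if "(a, b) \<in> ?H" "(b, c) \<in> ?H" for a b c
    using that * acyclic_irrefl[OF acyc] acyclic_no_triangle[OF acyc, of a b c] by auto
  ultimately have H: "acyclic ?H"
    using triangle_free_orientation_acyclic by blast
  have False if p: "dipath G p" "hd p = x" "last p = y" "length p \<ge> 3" for p
  proof -
    from p obtain m q where pq: "p = x # m # q" "q \<noteq> []"
      by (cases p; cases "tl p"; cases "tl (tl p)") auto
    \<comment> \<open>The path visits \<open>x\<close> only at its start and leaves it towards
      \<open>m\<close>, which is not \<open>y\<close>, so it never uses the flipped arc.\<close>
    have "successively (\<lambda>x y. (x, y) \<in> ?H) p"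
    proof -
      have "m \<noteq> y" using p pq by (auto simp: dipath_def)
      moreover have "successively (\<lambda>a b. (a, b) \<in> ?H) (m # q)"
      proof (rule successively_mono)
        show "successively (\<lambda>a b. (a, b) \<in> G) (m # q)"
          using p pq by (auto simp: dipath_def)
        show "(a, b) \<in> ?H" if "a \<in> set (m # q)" "b \<in> set (m # q)" "(a, b) \<in> G" for a b
          using that p pq by (auto simp: dipath_def)
      qed
      ultimately show ?thesis using p pq by (auto simp: dipath_def)
    qed
    then have "sorted_wrt (\<lambda>x y. (x, y) \<in> ?H\<^sup>+) p" by (rule walk_sorted_trancl)
    moreover have "y \<in> set q" using p pq by auto
    ultimately have "(x, y) \<in> ?H\<^sup>+" using pq by auto
    then have "(y, y) \<in> ?H\<^sup>+" by (meson insertI1 trancl_into_trancl2)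
    with H show False by (auto simp: acyclic_def)
  qed
  with * show "(x, y) \<in> transitive_reduction G"
    by (auto simp: transitive_reduction_def)
qed

lemma reorient_orientation:
  assumes "E \<subseteq> A"
  shows "orientation A (reorient A E)"
  using assms asym unfolding orientation_def reorient_def set_eq_iff by auto

text \<open>For arcs \<open>(x, y)\<close>, \<open>(y, z)\<close>, \<open>(x, z)\<close> of
  \<open>A\<close>, the reoriented triangle is a directed cycle exactly when \<open>(x, z)\<close>
  differs from both other arcs in being reversed or not; the two closure conditions forbid just
  this.\<close>

lemma acyclic_reorientations_iff:
  "E \<in> acyclic_reorientations A \<longleftrightarrow> E \<subseteq> A \<and> arc_closed A E \<and> arc_closed A (A - E)"
proof (intro iffI conjI)
  assume E: "E \<in> acyclic_reorientations A"
  then show "E \<subseteq> A" by (simp add: acyclic_reorientations_def)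
  have G: "acyclic (reorient A E)" using E by (simp add: acyclic_reorientations_def)
  show "arc_closed A E"
    unfolding arc_closed_def
  proof (intro allI impI, rule ccontr)
    fix x y z assume "(x, y) \<in> E \<and> (y, z) \<in> E \<and> (x, z) \<in> A" "(x, z) \<notin> E"
    then show False
      using acyclic_no_triangle[OF G, of z y x] by (auto simp: reorient_def)
  qed
  show "arc_closed A (A - E)"
    unfolding arc_closed_def
  proof (intro allI impI, rule ccontr)
    fix x y z assume "(x, y) \<in> A - E \<and> (y, z) \<in> A - E \<and> (x, z) \<in> A" "(x, z) \<notin> A - E"
    then show False
      using acyclic_no_triangle[OF G, of x y z] by (auto simp: reorient_def)
  qed
next
  assume E: "E \<subseteq> A \<and> arc_closed A E \<and> arc_closed A (A - E)"
  then have closed: "\<And>x y z. (x, y) \<in> E \<Longrightarrow> (y, z) \<in> E \<Longrightarrow> (x, z) \<in> A \<Longrightarrow> (x, z) \<in> E"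
      "\<And>x y z. (x, y) \<in> A \<Longrightarrow> (x, y) \<notin> E \<Longrightarrow> (y, z) \<in> A \<Longrightarrow> (y, z) \<notin> E \<Longrightarrow> (x, z) \<notin> E"
    and sub: "\<And>x y. (x, y) \<in> E \<Longrightarrow> (x, y) \<in> A"
    unfolding arc_closed_def by blast+
  have "acyclic (reorient A E)"
  proof (rule triangle_free_orientation_acyclic)
    show "orientation A (reorient A E)" using E reorient_orientation by blast
    fix x y z assume "(x, y) \<in> reorient A E" "(y, z) \<in> reorient A E"
    then show "(z, x) \<notin> reorient A E"
      using closed(1)[of z y x] closed(1)[of x z y] closed(1)[of y x z]
        closed(2)[of x y z] closed(2)[of y z x] closed(2)[of z x y]
        acyclic_no_triangle[OF acyclic, of x y z] acyclic_no_triangle[OF acyclic, of z y x]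
      by (auto simp: reorient_def dest: sub)
  qed
  with E show "E \<in> acyclic_reorientations A"
    by (simp add: acyclic_reorientations_def)
qed

lemma compl_acyclic_reorientations:
  "E \<in> acyclic_reorientations A \<Longrightarrow> A - E \<in> acyclic_reorientations A"
  by (auto simp: acyclic_reorientations_iff double_diff)

section \<open>Joins and meets of acyclic reorientations\<close>

text \<open>Every inner vertex of the \<open>S\<close>-path lies in the support of
  \<open>(x, z)\<close> and is hence equal or adjacent to \<open>w\<close>. Either the path passes
  through \<open>w\<close>, or one of its steps jumps from before \<open>w\<close> to after
  it.\<close>

lemma trancl_cut:
  assumes "(x, z) \<in> S\<^sup>+" "S \<subseteq> A" "(x, w) \<in> A" "(w, z) \<in> A" "(x, z) \<in> A"
  shows "(x, w) \<in> S\<^sup>+ \<and> (w, z) \<in> S\<^sup>+ \<or>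
    (\<exists>a b. (x, a) \<in> S\<^sup>* \<and> (a, b) \<in> S \<and> (b, z) \<in> S\<^sup>* \<and> (a, w) \<in> A \<and> (w, b) \<in> A)"
  using assms(1,3-)
proof (induction rule: converse_trancl_induct)
  case (base x)
  then show ?case by blast
next
  case (step x y)
  have "(x, y) \<in> A\<^sup>+" using step.hyps assms(2) by auto
  moreover have "(y, z) \<in> A\<^sup>+" using step.hyps(2) assms(2) by (meson trancl_mono subsetD)
  ultimately have y: "(x, y) \<in> A" "(y, z) \<in> A"
    using sandwich[of x y z] step.prems by auto
  then consider "y = w" | "(y, w) \<in> A" | "(w, y) \<in> A"
    using support_chain[OF step.prems(3), of y w] step.prems by auto
  then show ?case
  proof cases
    case 1
    then show ?thesis using step.hyps by blast
  next
    case 2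
    from step.IH[OF this step.prems(2) y(2)] step.hyps(1) show ?thesis
      by (meson converse_rtrancl_into_rtrancl trancl_into_trancl2)
  next
    case 3
    then show ?thesis using step by (meson rtrancl.rtrancl_refl trancl_into_rtrancl)
  qed
qed

lemma closure_acyclic_reorientation:
  assumes "X \<subseteq> acyclic_reorientations A"
  shows "A \<inter> (\<Union>X)\<^sup>+ \<in> acyclic_reorientations A"
  unfolding acyclic_reorientations_iff
proof (intro conjI)
  let ?S = "\<Union>X"
  show "arc_closed A (A \<inter> ?S\<^sup>+)"
    unfolding arc_closed_def by (blast intro: trancl_trans)
  show "arc_closed A (A - A \<inter> ?S\<^sup>+)"
    unfolding arc_closed_def
  proof (intro allI impI, rule ccontr)
    fix x w z
    assume H: "(x, w) \<in> A - A \<inter> ?S\<^sup>+ \<and> (w, z) \<in> A - A \<inter> ?S\<^sup>+ \<and> (x, z) \<in> A"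
      and "(x, z) \<notin> A - A \<inter> ?S\<^sup>+"
    then have "(x, z) \<in> ?S\<^sup>+" by blast
    moreover have "?S \<subseteq> A" using assms by (auto simp: acyclic_reorientations_def)
    ultimately obtain a b where ab: "(x, a) \<in> ?S\<^sup>*" "(a, b) \<in> ?S" "(b, z) \<in> ?S\<^sup>*"
      "(a, w) \<in> A" "(w, b) \<in> A"
      using trancl_cut[of x z ?S w] H by blast
    then obtain E where "E \<in> X" "(a, b) \<in> E" by blast
    \<comment> \<open>The step \<open>(a, b)\<close> belongs to a single reorientation
      \<open>E\<close> whose complement is closed, so it can be traded for a step that ends or
      starts at \<open>w\<close>.\<close>
    then have "(a, w) \<in> E \<or> (w, b) \<in> E"
      using assms ab unfolding acyclic_reorientations_iff subset_iff arc_closed_def by blast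
    then have "(a, w) \<in> ?S \<or> (w, b) \<in> ?S" using \<open>E \<in> X\<close> by blast
    then have "(x, w) \<in> ?S\<^sup>+ \<or> (w, z) \<in> ?S\<^sup>+"
      using ab by (meson rtrancl_into_trancl1 rtrancl_into_trancl2)
    with H show False by blast
  qed
qed simp

text \<open>If an arc of \<open>A\<close> joins the ends of an \<open>S\<close>-path, then by
  \<open>sandwich\<close> an arc joins the ends of its remainder too, so closedness of
  \<open>U\<close> applies one step at a time.\<close>

lemma closure_least:
  assumes "U \<in> acyclic_reorientations A" "S \<subseteq> U"
  shows "A \<inter> S\<^sup>+ \<subseteq> U"
proof -
  have "U \<subseteq> A" "arc_closed A U" using assms by (auto simp: acyclic_reorientations_iff)
  have "(x, z) \<in> A \<Longrightarrow> (x, z) \<in> U" if "(x, z) \<in> S\<^sup>+" for x z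
    using that
  proof (induction rule: converse_trancl_induct)
    case (base x)
    then show ?case using assms(2) by blast
  next
    case (step x y)
    have "S \<subseteq> A" using assms \<open>U \<subseteq> A\<close> by blast
    then have "(x, y) \<in> A" "(y, z) \<in> A\<^sup>+"
      using step.hyps by (auto intro: trancl_mono)
    then have "(y, z) \<in> A" using sandwich(2)[of x y z] step.prems by blast
    then show ?case
      using step arc_closedD[OF \<open>arc_closed A U\<close>] assms(2) by blast
  qed
  then show ?thesis by auto
qed

lemma sup_AR_poset:
  assumes "X \<subseteq> acyclic_reorientations A"
  shows "\<Squnion>\<^bsub>AR_poset A\<^esub> X = A \<inter> (\<Union>X)\<^sup>+"
proof -
  have up: "Upper (AR_poset A) X = {U \<in> acyclic_reorientations A. \<Union>X \<subseteq> U}"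
    using assms by (auto simp: Upper_def AR_poset_def)
  have "least (AR_poset A) (A \<inter> (\<Union>X)\<^sup>+) (Upper (AR_poset A) X)"
    unfolding least_def up
    using closure_acyclic_reorientation[OF assms] closure_least assms
    by (auto simp: AR_poset_def acyclic_reorientations_def)
  moreover have "M = A \<inter> (\<Union>X)\<^sup>+" if "least (AR_poset A) M (Upper (AR_poset A) X)" for M
    using that calculation by (auto simp: least_def AR_poset_def)
  ultimately show ?thesis
    unfolding sup_def by (rule some_equality)
qed

text \<open>Complementation reverses inclusion on the acyclic reorientations, so it exchanges
  greatest lower and least upper bounds.\<close>

lemma inf_AR_poset:
  assumes "X \<subseteq> acyclic_reorientations A"
  shows "\<Sqinter>\<^bsub>AR_poset A\<^esub> X = A - \<Squnion>\<^bsub>AR_poset A\<^esub> ((\<lambda>E. A - E) ` X)"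
proof -
  let ?Y = "(\<lambda>E. A - E) ` X"
  let ?M = "A - A \<inter> (\<Union>?Y)\<^sup>+"
  have Y: "?Y \<subseteq> acyclic_reorientations A"
    using assms compl_acyclic_reorientations by blast
  have low: "Lower (AR_poset A) X = {U \<in> acyclic_reorientations A. \<forall>E\<in>X. U \<subseteq> E}"
    using assms by (auto simp: Lower_def AR_poset_def)
  have "?M \<in> acyclic_reorientations A"
    by (intro compl_acyclic_reorientations closure_acyclic_reorientation Y)
  moreover have "?M \<subseteq> E" if "E \<in> X" for E
    using that r_into_trancl[of _ _ "\<Union>?Y"] by auto
  moreover have "U \<subseteq> ?M" if "U \<in> acyclic_reorientations A" "\<forall>E\<in>X. U \<subseteq> E" for U
  proof -
    have "\<Union>?Y \<subseteq> A - U" using that by blast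
    from closure_least[OF compl_acyclic_reorientations[OF that(1)] this] show ?thesis
      using that(1) by (auto simp: acyclic_reorientations_def)
  qed
  ultimately have "greatest (AR_poset A) ?M (Lower (AR_poset A) X)"
    unfolding greatest_def low by (auto simp: AR_poset_def)
  moreover have "M = ?M" if "greatest (AR_poset A) M (Lower (AR_poset A) X)" for M
    using that calculation by (simp add: greatest_def AR_poset_def subset_antisym)
  ultimately have "\<Sqinter>\<^bsub>AR_poset A\<^esub> X = ?M"
    unfolding inf_def by (rule some_equality)
  then show ?thesis by (simp add: sup_AR_poset[OF Y])
qed

section \<open>Ropes and descents\<close>

lemma transitive_support_eq:
  assumes "(u, v) \<in> A"
  shows "transitive_support A u v = {u, v} \<union> {w. (u, w) \<in> A \<and> (w, v) \<in> A}"
proof (intro equalityI subsetI)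
  fix w assume "w \<in> transitive_support A u v"
  then obtain p where p: "dipath A p" "hd p = u" "last p = v" "w \<in> set p"
    by (auto simp: transitive_support_def)
  then have "sorted_wrt (\<lambda>x y. (x, y) \<in> A) p"
    using skeletal assms unfolding skeletal_def filled_def by blast
  moreover obtain ys zs where "p = ys @ w # zs" using p(4) by (meson split_list)
  ultimately show "w \<in> {u, v} \<union> {w. (u, w) \<in> A \<and> (w, v) \<in> A}"
    using p by (cases ys; cases zs rule: rev_cases) (auto simp: sorted_wrt_append)
next
  fix w assume "w \<in> {u, v} \<union> {w. (u, w) \<in> A \<and> (w, v) \<in> A}"
  then consider "w \<in> {u, v}" | "(u, w) \<in> A" "(w, v) \<in> A" by blast
  then show "w \<in> transitive_support A u v"
  proof cases
    case 1
    have "dipath A [u, v]" using assms by (simp add: dipath_acyclic_iff[OF acyclic])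
    with 1 show ?thesis unfolding transitive_support_def by force
  next
    case 2
    then have "dipath A [u, w, v]" by (simp add: dipath_acyclic_iff[OF acyclic])
    then show ?thesis unfolding transitive_support_def by force
  qed
qed

lemma ropes_iff:
  "(u, v, N, T) \<in> ropes A \<longleftrightarrow>
    (u, v) \<in> A \<and> N \<union> T = {w. (u, w) \<in> A \<and> (w, v) \<in> A} \<and> N \<inter> T = {}"
proof -
  have "transitive_support A u v - {u, v} = {w. (u, w) \<in> A \<and> (w, v) \<in> A}" if "(u, v) \<in> A"
    unfolding transitive_support_eq[OF that] using irrefl by auto
  then show ?thesis by (cases "(u, v) \<in> A") (simp_all add: ropes_def)
qed

text \<open>No two arcs of \<open>I_join\<close> compose, because \<open>T \<union> {u}\<close> and
  \<open>N \<union> {v}\<close> are disjoint. If one of its arcs factors through \<open>y\<close>,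
  then \<open>y\<close> lies in the support, hence in \<open>N\<close> or \<open>T\<close>, and one
  of the two factors is in \<open>I_join\<close> as well.\<close>

lemma I_join_acyclic_reorientation:
  assumes "\<rho> \<in> ropes A"
  shows "I_join A \<rho> \<in> acyclic_reorientations A"
proof -
  obtain u v N T where \<rho>: "\<rho> = (u, v, N, T)" by (cases \<rho>)
  with assms have rope: "(u, v) \<in> A" "N \<inter> T = {}"
    and NT: "w \<in> N \<or> w \<in> T \<longleftrightarrow> (u, w) \<in> A \<and> (w, v) \<in> A" for w
    by (auto simp: ropes_iff)
  have uv: "u \<notin> N" "v \<notin> T" "u \<noteq> v"
    using NT[of u] NT[of v] irrefl rope(1) by auto
  show ?thesis
    unfolding acyclic_reorientations_iff
  proof (intro conjI)
    show "I_join A \<rho> \<subseteq> A" using \<rho> by auto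
    show "arc_closed A (I_join A \<rho>)"
      unfolding arc_closed_def using \<rho> rope uv by auto
    show "arc_closed A (A - I_join A \<rho>)"
      unfolding arc_closed_def
    proof (intro allI impI, rule ccontr)
      fix x y z
      assume H: "(x, y) \<in> A - I_join A \<rho> \<and> (y, z) \<in> A - I_join A \<rho> \<and> (x, z) \<in> A"
        and "(x, z) \<notin> A - I_join A \<rho>"
      then have xz: "x \<in> T \<union> {u}" "z \<in> N \<union> {v}" using \<rho> by auto
      have ux: "(u, x) \<in> A\<^sup>*" and zv: "(z, v) \<in> A\<^sup>*" using xz NT by auto
      have "(u, y) \<in> A\<^sup>+" using ux H by (meson DiffD1 rtrancl_into_trancl1)
      moreover have "(y, v) \<in> A\<^sup>+" using zv H by (meson DiffD1 rtrancl_into_trancl2)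
      ultimately have "y \<in> N \<or> y \<in> T" using sandwich[of u y v] rope(1) NT by blast
      then show False using H xz \<rho> by auto
    qed
  qed
qed

lemma E_join_eq:
  assumes "R \<subseteq> ropes A"
  shows "E_join A R = A \<inter> (\<Union>\<rho>\<in>R. I_join A \<rho>)\<^sup>+"
  unfolding E_join_def using assms I_join_acyclic_reorientation by (intro sup_AR_poset) blast

lemma E_join_acyclic_reorientation:
  assumes "R \<subseteq> ropes A"
  shows "E_join A R \<in> acyclic_reorientations A"
  unfolding E_join_eq[OF assms] using assms I_join_acyclic_reorientation
  by (intro closure_acyclic_reorientation) blast

text \<open>If \<open>A\<close> is a transitive tournament and the reorientation is acyclic, these
  are the descents of the resulting permutation: reversed pairs that are consecutive.\<close>

definition descent :: "'a rel \<Rightarrow> 'a \<Rightarrow> 'a \<Rightarrow> bool" where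
  "descent E u v \<longleftrightarrow> (u, v) \<in> E \<and> (\<forall>z. (v, z) \<in> reorient A E \<longrightarrow> (z, u) \<notin> reorient A E)"

lemma reorient_arc_iff:
  assumes "E \<subseteq> A" "(x, y) \<in> A"
  shows "(x, y) \<in> reorient A E \<longleftrightarrow> (x, y) \<notin> E"
  using assms asym[OF assms(2)] by (auto simp: reorient_def)

lemma nabla_set_eq:
  assumes "E \<subseteq> A"
  shows "nabla_set V A E u v = {w. (u, w) \<in> E \<and> (w, v) \<in> A - E}"
  using assms arcs_V by (auto simp: nabla_set_def reorient_arc_iff[OF assms])

lemma delta_set_eq:
  assumes "E \<subseteq> A"
  shows "delta_set V A E u v = {w. (u, w) \<in> A - E \<and> (w, v) \<in> E}"
  using assms arcs_V by (auto simp: delta_set_def reorient_arc_iff[OF assms])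

lemma delta_join_eq:
  assumes "E \<in> acyclic_reorientations A"
  shows "delta_join V A E = {rope_of V A E u v | u v. descent E u v}"
proof -
  have E: "E \<subseteq> A" "acyclic (reorient A E)"
    using assms by (auto simp: acyclic_reorientations_def)
  have "(u, v) \<in> A \<and> (v, u) \<in> transitive_reduction (reorient A E) \<longleftrightarrow> descent E u v" for u v
  proof -
    have "(u, v) \<in> A \<and> (v, u) \<in> reorient A E \<longleftrightarrow> (u, v) \<in> E"
      using E(1) by (auto simp: reorient_def subset_iff dest: asym)
    then show ?thesis
      unfolding transitive_reduction_orientation_iff[OF reorient_orientation[OF E(1)] E(2)]
        descent_def by blast
  qed
  then show ?thesis by (simp add: delta_join_def)
qed

text \<open>At a vertex \<open>w\<close> of the support exactly one of \<open>(u, w)\<close> and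
  \<open>(w, v)\<close> is reversed: two reversed arcs would put \<open>w\<close> between
  \<open>v\<close> and \<open>u\<close>, and two unreversed ones would leave \<open>(u, v)\<close>
  unreversed.\<close>

lemma rope_of_ropes:
  assumes "E \<in> acyclic_reorientations A" "descent E u v"
  shows "rope_of V A E u v \<in> ropes A"
proof -
  have E: "E \<subseteq> A" "arc_closed A (A - E)"
    using assms by (auto simp: acyclic_reorientations_iff)
  have "(u, w) \<notin> E" if "(w, v) \<in> E" for w
    using that assms(2) by (auto simp: descent_def reorient_def)
  moreover have "(u, w) \<in> E" if "(w, v) \<notin> E" "(u, w) \<in> A" "(w, v) \<in> A" for w
    using that E assms(2) unfolding arc_closed_def descent_def by blast
  ultimately show ?thesis
    using E(1) assms(2)
    by (auto simp: rope_of_def ropes_iff nabla_set_eq delta_set_eq descent_def)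
qed

text \<open>The linear order in which a descent \<open>(u, v)\<close> lists its support is
  \<open>\<nabla>\<close>, \<open>v\<close>, \<open>u\<close>, \<open>\<Delta>\<close>.\<close>

lemma descent_order:
  assumes "E \<subseteq> A" "descent E u v" "w \<noteq> w'"
    and "w \<in> nabla_set V A E u v \<union> {u, v}" "w' \<in> delta_set V A E u v \<union> {u, v}"
  shows "(w, w') \<in> (reorient A E)\<^sup>+ \<or> w = u \<and> w' = v"
proof -
  let ?G = "reorient A E"
  have "(v, u) \<in> ?G" using assms(2) by (auto simp: descent_def reorient_def)
  moreover have "(w, u) \<in> ?G \<and> (w, v) \<in> ?G" if "w \<in> nabla_set V A E u v"
    using that assms(1) by (auto simp: nabla_set_eq reorient_def)
  moreover have "(u, w') \<in> ?G \<and> (v, w') \<in> ?G" if "w' \<in> delta_set V A E u v"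
    using that assms(1) by (auto simp: delta_set_eq reorient_def)
  ultimately show ?thesis
    using assms(3-) by (auto intro: trancl_into_trancl)
qed

text \<open>Handles the exceptional case of \<open>descent_order\<close>. Unless the two arcs agree,
  \<open>u'\<close> or \<open>v'\<close> lies strictly between \<open>v\<close> and \<open>u\<close>
  in the reoriented graph, against the descent property, or \<open>A\<close> contains a loop or
  opposite arcs.\<close>

lemma descent_unique:
  assumes "E \<subseteq> A" "descent E u v" "descent E u' v'"
    and "u \<in> delta_set V A E u' v' \<union> {u', v'}" "v \<in> nabla_set V A E u' v' \<union> {u', v'}"
  shows "u = u' \<and> v = v'"
proof -
  let ?G = "reorient A E"
  have uv: "(u, v) \<in> A" "\<And>z. (v, z) \<in> ?G \<Longrightarrow> (z, u) \<notin> ?G"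
    and u'v': "(u', v') \<in> A"
    using assms(1-3) by (auto simp: descent_def)
  consider "(u', u) \<in> A" "(u', u) \<in> ?G" "(v', u) \<in> ?G" | "u = u'" | "u = v'"
    using assms(1,4) by (auto simp: delta_set_eq reorient_def)
  moreover consider "(v, v') \<in> A" "(v, u') \<in> ?G" "(v, v') \<in> ?G" | "v = v'" | "v = u'"
    using assms(1,5) by (auto simp: nabla_set_eq reorient_def)
  moreover have "(v', u') \<in> ?G"
    using assms(3) by (auto simp: descent_def reorient_def)
  ultimately show ?thesis
    using uv u'v' asym irrefl by metis
qed

text \<open>The two ropes order a crossing pair in opposite ways, which would give a directed cycle;
  in the exceptional cases the two descents coincide.\<close>

lemma delta_join_noncrossing:
  assumes "E \<in> acyclic_reorientations A"
  shows "delta_join V A E \<in> noncrossing_diagrams A"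
proof -
  have E: "E \<subseteq> A" and G: "acyclic (reorient A E)"
    using assms by (auto simp: acyclic_reorientations_def)
  have "u = u' \<and> v = v'"
    if d: "descent E u v" "descent E u' v'"
      and "crossing (rope_of V A E u v) (rope_of V A E u' v')" for u v u' v'
  proof -
    from that(3) obtain w w' where w: "w \<noteq> w'"
      "w \<in> nabla_set V A E u v \<union> {u, v}" "w \<in> delta_set V A E u' v' \<union> {u', v'}"
      "w' \<in> delta_set V A E u v \<union> {u, v}" "w' \<in> nabla_set V A E u' v' \<union> {u', v'}"
      unfolding rope_of_def crossing.simps by blast
    then consider "(w, w') \<in> (reorient A E)\<^sup>+" "(w', w) \<in> (reorient A E)\<^sup>+"
      | "w = u" "w' = v" | "w' = u'" "w = v'"
      using descent_order[OF E d(1), of w w'] descent_order[OF E d(2), of w' w] by blast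
    then show ?thesis
    proof cases
      case 1
      then show ?thesis using G by (meson acyclic_def trancl_trans)
    next
      case 2
      then show ?thesis using descent_unique[OF E d] w(3,5) by blast
    next
      case 3
      then show ?thesis using descent_unique[OF E d(2,1)] w(2,4) by blast
    qed
  qed
  then have "\<not> crossing \<rho> \<sigma>" if "\<rho> \<in> delta_join V A E" "\<sigma> \<in> delta_join V A E" "\<rho> \<noteq> \<sigma>" for \<rho> \<sigma>
    using that unfolding delta_join_eq[OF assms] by auto
  moreover have "delta_join V A E \<subseteq> ropes A"
    using rope_of_ropes[OF assms] unfolding delta_join_eq[OF assms] by auto
  ultimately show ?thesis by (simp add: noncrossing_diagrams_def)
qed

section \<open>The two maps are inverse to each other\<close>

text \<open>Induction on the number of vertices between the ends of an arc: an arc outside the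
  reduction factors through some \<open>z\<close>, and \<open>z\<close> is no longer counted for
  either factor.\<close>

lemma reorient_subset_transitive_reduction_trancl:
  assumes "E \<in> acyclic_reorientations A"
  shows "reorient A E \<subseteq> (transitive_reduction (reorient A E))\<^sup>+"
proof
  let ?G = "reorient A E"
  have E: "E \<subseteq> A" "acyclic ?G"
    using assms by (auto simp: acyclic_reorientations_def)
  have GV: "?G \<subseteq> V \<times> V" using E(1) arcs_V by (auto simp: reorient_def)
  define between where "between x y = {z. (x, z) \<in> ?G\<^sup>+ \<and> (z, y) \<in> ?G\<^sup>+}" for x y
  have fin: "finite (between x y)" for x y
    using finite_V trancl_subset_Sigma[OF GV] by (auto simp: between_def intro: finite_subset)
  have "(x, y) \<in> ?G \<Longrightarrow> (x, y) \<in> (transitive_reduction ?G)\<^sup>+" for x y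
  proof (induction "card (between x y)" arbitrary: x y rule: less_induct)
    case less
    show ?case
    proof (cases "(x, y) \<in> transitive_reduction ?G")
      case False
      with less.prems obtain z where z: "(x, z) \<in> ?G" "(z, y) \<in> ?G"
        using transitive_reduction_orientation_iff[OF reorient_orientation[OF E(1)] E(2)] by blast
      have "between x z \<subset> between x y" "between z y \<subset> between x y"
        using z E(2) unfolding between_def acyclic_def
        by (auto intro: trancl_trans r_into_trancl dest: trancl_into_trancl trancl_into_trancl2)
      then have "card (between x z) < card (between x y)" "card (between z y) < card (between x y)"
        by (simp_all add: fin psubset_card_mono)
      with less.hyps z show ?thesis by (meson trancl_trans)
    qed auto
  qed
  then show "p \<in> ?G \<Longrightarrow> p \<in> (transitive_reduction ?G)\<^sup>+" for p
    by (cases p) simp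
qed

lemma E_join_delta_join:
  assumes "E \<in> acyclic_reorientations A"
  shows "E_join A (delta_join V A E) = E"
proof -
  let ?R = "delta_join V A E"
  let ?F = "E_join A ?R"
  let ?G = "reorient A E"
  have R: "?R \<subseteq> ropes A"
    using delta_join_noncrossing[OF assms] by (simp add: noncrossing_diagrams_def)
  have E: "E \<subseteq> A" "arc_closed A (A - E)"
    using assms by (auto simp: acyclic_reorientations_iff)
  have F: "?F \<subseteq> A" "acyclic (reorient A ?F)"
    using E_join_acyclic_reorientation[OF R] by (auto simp: acyclic_reorientations_def)
  have "I_join A (rope_of V A E u v) \<subseteq> E" if "descent E u v" for u v
  proof -
    \<comment> \<open>The arc \<open>(u, w')\<close> is reversed while \<open>(u, w)\<close> is not;
      an unreversed \<open>(w, w')\<close> would contradict closedness of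
      \<open>A - E\<close>.\<close>
    have "(w, w') \<in> E" if "(w, w') \<in> A" "(u, w) \<in> A - E" "(u, w') \<in> E" for w w'
      using that E unfolding arc_closed_def by blast
    then show ?thesis
      using that E(1)
      by (auto simp: rope_of_def nabla_set_eq delta_set_eq descent_def)
  qed
  then have "I_join A \<rho> \<subseteq> E" if "\<rho> \<in> ?R" for \<rho>
    using that unfolding delta_join_eq[OF assms] by blast
  then have "(\<Union>\<rho>\<in>?R. I_join A \<rho>) \<subseteq> E"
    by (rule UN_least)
  then have "?F \<subseteq> E"
    unfolding E_join_eq[OF R] by (rule closure_least[OF assms])
  \<comment> \<open>Unreversed arcs stay so because \<open>?F \<subseteq> E\<close>; a reversed arc
    of the reduction lies in the \<open>I_join\<close> of its own rope.\<close>
  have "transitive_reduction ?G \<subseteq> reorient A ?F"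
  proof (rule subrelI)
    fix x y assume xy: "(x, y) \<in> transitive_reduction ?G"
    then have "(x, y) \<in> ?G" by (auto simp: transitive_reduction_def)
    then consider "(x, y) \<in> A - E" | "(y, x) \<in> E" by (auto simp: reorient_def)
    then show "(x, y) \<in> reorient A ?F"
    proof cases
      case 1
      then show ?thesis using \<open>?F \<subseteq> E\<close> by (auto simp: reorient_def)
    next
      case 2
      then have "(y, x) \<in> I_join A (rope_of V A E y x)" "rope_of V A E y x \<in> ?R"
        using xy E(1) by (auto simp: rope_of_def delta_join_def)
      then have "(y, x) \<in> ?F" unfolding E_join_eq[OF R] using 2 E(1) by blast
      then show ?thesis by (auto simp: reorient_def)
    qed
  qed
  then have sub: "?G \<subseteq> (reorient A ?F)\<^sup>+"
    using reorient_subset_transitive_reduction_trancl[OF assms] by (meson subset_trans trancl_mono_subset)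
  \<comment> \<open>An arc reversed in \<open>E\<close> but not in \<open>?F\<close> would close a
    directed cycle in \<open>reorient A ?F\<close>.\<close>
  have "E \<subseteq> ?F"
  proof (rule subrelI, rule ccontr)
    fix x y assume "(x, y) \<in> E" "(x, y) \<notin> ?F"
    then have "(y, x) \<in> (reorient A ?F)\<^sup>+" "(x, y) \<in> reorient A ?F"
      using sub E(1) by (auto simp: reorient_def)
    then show False using F(2) by (meson acyclic_def trancl_into_trancl)
  qed
  with \<open>?F \<subseteq> E\<close> show ?thesis by blast
qed

end

section \<open>The join of a fixed non-crossing diagram\<close>

locale noncrossing_diagram = skeletal_dag +
  fixes R :: "'a rope set"
  assumes noncrossing: "R \<in> noncrossing_diagrams A"
begin

definition steps :: "'a rel" where
  "steps = (\<Union>\<rho>\<in>R. I_join A \<rho>)"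

lemma R_ropes: "R \<subseteq> ropes A"
  using noncrossing by (simp add: noncrossing_diagrams_def)

lemma steps_A: "steps \<subseteq> A"
  by (auto simp: steps_def)

lemma E_join_steps: "E_join A R = A \<inter> steps\<^sup>+"
  by (simp add: E_join_eq[OF R_ropes] steps_def)

lemma stepE:
  assumes "(x, y) \<in> steps"
  obtains u v N T where "(u, v, N, T) \<in> R" "(x, y) \<in> A" "x \<in> T \<union> {u}" "y \<in> N \<union> {v}"
  using assms by (force simp: steps_def)

lemma stepI:
  assumes "(u, v, N, T) \<in> R" "(x, y) \<in> A" "x \<in> T \<union> {u}" "y \<in> N \<union> {v}"
  shows "(x, y) \<in> steps"
  using assms by (force simp: steps_def)

lemma crossing_eq:
  assumes "(u, v, N, T) \<in> R" "(u', v', N', T') \<in> R" "x \<noteq> y"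
    and "x \<in> N \<union> {u, v}" "x \<in> T' \<union> {u', v'}" "y \<in> T \<union> {u, v}" "y \<in> N' \<union> {u', v'}"
  shows "(u, v, N, T) = (u', v', N', T')"
proof (rule ccontr)
  assume "(u, v, N, T) \<noteq> (u', v', N', T')"
  then have "\<not> crossing (u, v, N, T) (u', v', N', T')"
    using noncrossing assms(1,2) by (simp add: noncrossing_diagrams_def del: crossing.simps)
  moreover have "crossing (u, v, N, T) (u', v', N', T')"
    unfolding crossing.simps using assms(3-) by (intro exI[of _ x] exI[of _ y]) simp
  ultimately show False ..
qed

context
  fixes u v N T
  assumes rope: "(u, v, N, T) \<in> R"
begin

lemma rope_arc: "(u, v) \<in> A"
  and rope_support: "w \<in> N \<or> w \<in> T \<longleftrightarrow> (u, w) \<in> A \<and> (w, v) \<in> A"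
  and rope_disjoint: "w \<in> N \<Longrightarrow> w \<notin> T"
  using subsetD[OF R_ropes rope] by (auto simp: ropes_iff set_eq_iff)

lemma rope_ends: "u \<noteq> v" "u \<notin> N" "u \<notin> T" "v \<notin> N" "v \<notin> T"
  using rope_arc rope_support irrefl by blast+

text \<open>The step comes from a rope with \<open>x\<close> in \<open>T' \<union> {u'}\<close> and
  \<open>y\<close> in \<open>N' \<union> {v'}\<close>, so \<open>x\<close> and \<open>y\<close>
  witness a crossing unless that rope is the given one, where only \<open>u\<close> and
  \<open>v\<close> fit.\<close>

lemma step_across_rope:
  assumes "(x, y) \<in> steps" "x \<in> N \<union> {u}" "y \<in> T \<union> {v}"
  shows "x = u \<and> y = v"
proof -
  from assms(1) obtain u' v' N' T' where
    s: "(u', v', N', T') \<in> R" "(x, y) \<in> A" "x \<in> T' \<union> {u'}" "y \<in> N' \<union> {v'}"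
    by (rule stepE)
  then have "(u, v, N, T) = (u', v', N', T')"
    using assms irrefl by (intro crossing_eq[OF rope s(1), of x y]) auto
  with s assms show ?thesis using rope_disjoint by blast
qed

text \<open>Some step leaves \<open>N \<union> {u}\<close>. Its end lies in the support or is
  \<open>v\<close>, hence is in \<open>T \<union> {v}\<close>, so the step is \<open>(u, v)\<close>
  itself, and acyclicity of \<open>A\<close> leaves no room for further steps.\<close>

lemma path_across_rope:
  assumes "(x, y) \<in> steps\<^sup>*" "x \<in> N \<union> {u}" "y \<in> T \<union> {v}"
  shows "x = u \<and> y = v"
proof -
  have "y \<notin> N \<union> {u}" using assms(3) rope_disjoint rope_ends by blast
  with rtrancl_crossing_step[OF assms(1), of "\<lambda>a. a \<in> N \<union> {u}"] assms(2)
  obtain a b where ab: "(x, a) \<in> steps\<^sup>*" "(a, b) \<in> steps" "(b, y) \<in> steps\<^sup>*"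
    "a \<in> N \<union> {u}" "b \<notin> N \<union> {u}" by blast
  have star: "steps\<^sup>* \<subseteq> A\<^sup>*" using steps_A by (rule rtrancl_mono)
  have ua: "(u, a) \<in> A\<^sup>*" and ux: "(u, x) \<in> A\<^sup>*" and yv: "(y, v) \<in> A\<^sup>*"
    using ab assms rope_support by auto
  have "(u, b) \<in> A\<^sup>+" using ua ab(2) steps_A by (meson rtrancl_into_trancl1 subsetD)
  moreover have "(b, v) \<in> A\<^sup>*" using ab(3) yv star by (meson rtrancl_trans subsetD)
  ultimately have "b = v \<or> (u, b) \<in> A \<and> (b, v) \<in> A"
    using sandwich[of u b v] rope_arc by (metis rtranclD)
  then have "b \<in> T \<union> {v}" using ab(5) rope_support by blast
  then have "a = u" "b = v" using step_across_rope[OF ab(2,4)] by auto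
  then show ?thesis
    using acyclic_rtrancl_antisym[OF acyclic] ab star ux yv by blast
qed

lemma rope_join:
  shows "(u, v) \<in> E_join A R"
    and "w \<in> N \<Longrightarrow> (u, w) \<in> E_join A R" "w \<in> N \<Longrightarrow> (w, v) \<in> A - E_join A R"
    and "w \<in> T \<Longrightarrow> (w, v) \<in> E_join A R" "w \<in> T \<Longrightarrow> (u, w) \<in> A - E_join A R"
proof -
  show "(u, v) \<in> E_join A R"
    using stepI[OF rope] rope_arc by (auto simp: E_join_steps)
  show "w \<in> N \<Longrightarrow> (u, w) \<in> E_join A R"
    using stepI[OF rope] rope_support by (auto simp: E_join_steps)
  show "w \<in> T \<Longrightarrow> (w, v) \<in> E_join A R"
    using stepI[OF rope] rope_support by (auto simp: E_join_steps)
  \<comment> \<open>A path from \<open>w\<close> to \<open>v\<close> would lead across the rope and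
    force \<open>w = u\<close>; for \<open>w\<close> in \<open>T\<close>, a path from
    \<open>u\<close> to \<open>w\<close> would force \<open>w = v\<close>.\<close>
  show "w \<in> N \<Longrightarrow> (w, v) \<in> A - E_join A R"
    using path_across_rope[of w v] rope_support rope_ends
    by (auto simp: E_join_steps dest: trancl_into_rtrancl)
  show "w \<in> T \<Longrightarrow> (u, w) \<in> A - E_join A R"
    using path_across_rope[of u w] rope_support rope_ends
    by (auto simp: E_join_steps dest: trancl_into_rtrancl)
qed

text \<open>Excludes that a vertex \<open>w\<close> after \<open>v\<close> in \<open>A\<close> comes
  between \<open>v\<close> and \<open>u\<close> once reoriented. The path from \<open>u\<close> to
  \<open>w\<close> would need a step over \<open>v\<close>.\<close>

lemma no_detour_above:
  assumes "(u, w) \<in> E_join A R" "(v, w) \<in> A - E_join A R"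
  shows False
proof -
  have *: "(u, w) \<in> A" "(u, w) \<in> steps\<^sup>+" "(v, w) \<in> A" "(v, w) \<notin> steps\<^sup>+"
    using assms by (auto simp: E_join_steps)
  then obtain a b where ab: "(u, a) \<in> steps\<^sup>*" "(a, b) \<in> steps" "(b, w) \<in> steps\<^sup>*"
    "(a, v) \<in> A" "(v, b) \<in> A"
    using trancl_cut[of u w steps v] steps_A rope_arc by blast
  from ab(2) obtain u' v' N' T' where
    s: "(u', v', N', T') \<in> R" "(a, b) \<in> A" "a \<in> T' \<union> {u'}" "b \<in> N' \<union> {v'}"
    by (rule stepE)
  from subsetD[OF R_ropes s(1)]
  have sup': "x \<in> N' \<or> x \<in> T' \<longleftrightarrow> (u', x) \<in> A \<and> (x, v') \<in> A"
    and arc': "(u', v') \<in> A" for x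
    by (auto simp: ropes_iff set_eq_iff)
  have "(u', v) \<in> A\<^sup>+" "(v, v') \<in> A\<^sup>+"
    using s sup' ab(4,5) by (auto intro: trancl_into_trancl2 trancl_into_trancl)
  then have "v \<in> N' \<or> v \<in> T'" using sandwich[OF _ _ arc'] sup' by blast
  moreover have "v \<notin> T'"
  proof
    assume "v \<in> T'"
    then have "(v, b) \<in> steps" using stepI[OF s(1)] ab(5) s(4) by blast
    with ab(3) *(4) show False by (meson rtrancl_into_trancl2)
  qed
  ultimately have v: "v \<in> N'" by blast
  have "(u, a) \<in> A\<^sup>*" using ab(1) rtrancl_mono[OF steps_A] by blast
  then have "a = u \<or> (u, a) \<in> A" using sandwich(1)[of u a v] rope_arc ab(4) by (metis rtranclD r_into_trancl)
  \<comment> \<open>For \<open>a\<close> in \<open>N \<union> {u}\<close>, the pair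
    \<open>a\<close>, \<open>v\<close> makes the two ropes cross; for \<open>a\<close> in
    \<open>T\<close>, the path from \<open>u\<close> to \<open>a\<close> has led across the given
    rope.\<close>
  then consider "a \<in> N \<union> {u}" | "a \<in> T" using rope_support ab(4) by blast
  then show False
  proof cases
    case 1
    then have "(u, v, N, T) = (u', v', N', T')"
      using s v ab(4) irrefl by (intro crossing_eq[OF rope s(1), of a v]) auto
    then show False using v rope_ends by blast
  next
    case 2
    then show False using path_across_rope[OF ab(1)] rope_ends by blast
  qed
qed

text \<open>Mirror image of \<open>no_detour_above\<close>: the step goes over \<open>u\<close>, and
  \<open>a\<close> and \<open>b\<close> as well as \<open>N\<close> and \<open>T\<close> exchange
  roles.\<close>

lemma no_detour_below:
  assumes "(w, v) \<in> E_join A R" "(w, u) \<in> A - E_join A R"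
  shows False
proof -
  have *: "(w, v) \<in> A" "(w, v) \<in> steps\<^sup>+" "(w, u) \<in> A" "(w, u) \<notin> steps\<^sup>+"
    using assms by (auto simp: E_join_steps)
  then obtain a b where ab: "(w, a) \<in> steps\<^sup>*" "(a, b) \<in> steps" "(b, v) \<in> steps\<^sup>*"
    "(a, u) \<in> A" "(u, b) \<in> A"
    using trancl_cut[of w v steps u] steps_A rope_arc by blast
  from ab(2) obtain u' v' N' T' where
    s: "(u', v', N', T') \<in> R" "(a, b) \<in> A" "a \<in> T' \<union> {u'}" "b \<in> N' \<union> {v'}"
    by (rule stepE)
  from subsetD[OF R_ropes s(1)]
  have sup': "x \<in> N' \<or> x \<in> T' \<longleftrightarrow> (u', x) \<in> A \<and> (x, v') \<in> A"
    and arc': "(u', v') \<in> A" for x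
    by (auto simp: ropes_iff set_eq_iff)
  have "(u', u) \<in> A\<^sup>+" "(u, v') \<in> A\<^sup>+"
    using s sup' ab(4,5) by (auto intro: trancl_into_trancl2 trancl_into_trancl)
  then have "u \<in> N' \<or> u \<in> T'" using sandwich[OF _ _ arc'] sup' by blast
  moreover have "u \<notin> N'"
  proof
    assume "u \<in> N'"
    then have "(a, u) \<in> steps" using stepI[OF s(1)] ab(4) s(3) by blast
    with ab(1) *(4) show False by (meson rtrancl_into_trancl1)
  qed
  ultimately have u: "u \<in> T'" by blast
  have "(b, v) \<in> A\<^sup>*" using ab(3) rtrancl_mono[OF steps_A] by blast
  then have "b = v \<or> (b, v) \<in> A" using sandwich(2)[of u b v] rope_arc ab(5) by (metis rtranclD r_into_trancl)
  then consider "b \<in> T \<union> {v}" | "b \<in> N" using rope_support ab(5) by blast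
  then show False
  proof cases
    case 1
    then have "(u, v, N, T) = (u', v', N', T')"
      using s u ab(5) irrefl by (intro crossing_eq[OF rope s(1), of u b]) auto
    then show False using u rope_ends by blast
  next
    case 2
    then show False using path_across_rope[OF ab(3)] rope_ends by blast
  qed
qed

lemma rope_descent: "descent (E_join A R) u v"
  unfolding descent_def
proof (intro conjI allI impI notI)
  let ?F = "E_join A R"
  show "(u, v) \<in> ?F" by (rule rope_join)
  fix z assume z: "(v, z) \<in> reorient A ?F" "(z, u) \<in> reorient A ?F"
  \<comment> \<open>A detour through \<open>z\<close> would have \<open>z\<close> between
    \<open>u\<close> and \<open>v\<close>, after \<open>v\<close>, or before \<open>u\<close> in
    \<open>A\<close>. In the first case both arcs at \<open>z\<close> would be reversed, but the
    rope reverses only one of them.\<close>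
  have "\<not> ((z, v) \<in> ?F \<and> (u, z) \<in> ?F)"
    using rope_support[of z] rope_join(3,5)[of z] by (auto simp: E_join_steps)
  then show False
    using z no_detour_above[of z] no_detour_below[of z] rope_arc
      acyclic_no_triangle[OF acyclic, of u v z]
    by (auto simp: reorient_def)
qed

text \<open>As the left side depends on the arc only, a non-crossing diagram has at most one rope on
  each arc.\<close>

lemma rope_of_E_join: "rope_of V A (E_join A R) u v = (u, v, N, T)"
proof -
  let ?F = "E_join A R"
  have F: "?F \<subseteq> A" by (auto simp: E_join_steps)
  have "(u, w) \<in> ?F \<and> (w, v) \<in> A - ?F \<longleftrightarrow> w \<in> N" "(u, w) \<in> A - ?F \<and> (w, v) \<in> ?F \<longleftrightarrow> w \<in> T" for w
    using rope_support[of w] rope_join(2-5)[of w] subsetD[OF F] by auto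
  then show ?thesis by (simp add: rope_of_def nabla_set_eq[OF F] delta_set_eq[OF F])
qed

end

text \<open>A path of several steps would put its second vertex between \<open>v\<close> and
  \<open>u\<close>, so \<open>(u, v)\<close> is a single step, coming from a rope with ends
  \<open>a\<close> and \<open>b\<close>. If \<open>u\<close> were in \<open>T\<close>, then
  \<open>a\<close> would lie between \<open>v\<close> and \<open>u\<close>; if \<open>v\<close> were
  in \<open>N\<close>, then \<open>b\<close> would.\<close>

lemma descent_E_join_rope:
  assumes "descent (E_join A R) u v"
  shows "\<exists>N T. (u, v, N, T) \<in> R"
proof -
  let ?F = "E_join A R"
  let ?G = "reorient A ?F"
  have cover: "(z, u) \<notin> ?G" if "(v, z) \<in> ?G" for z
    using assms that unfolding descent_def by blast
  have "(u, v) \<in> ?F"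
    using assms unfolding descent_def by blast
  then have uv: "(u, v) \<in> A" "(u, v) \<in> steps\<^sup>+"
    by (simp_all add: E_join_steps)
  have "(u, v) \<in> steps"
  proof (rule ccontr)
    assume "(u, v) \<notin> steps"
    obtain z where z: "(u, z) \<in> steps" "(z, v) \<in> steps\<^sup>+"
    proof (rule converse_tranclE[OF uv(2)])
      assume "(u, v) \<in> steps"
      with \<open>(u, v) \<notin> steps\<close> show thesis ..
    qed
    then have "(u, z) \<in> A\<^sup>+" "(z, v) \<in> A\<^sup>+"
      using trancl_mono[OF r_into_trancl steps_A] trancl_mono[OF _ steps_A] by metis+
    then have "(u, z) \<in> A" "(z, v) \<in> A"
      using sandwich[OF _ _ uv(1)] by blast+
    then have "(u, z) \<in> ?F" "(z, v) \<in> ?F"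
      using z by (simp_all add: E_join_steps)
    then show False using cover[of z] by (auto simp: reorient_def)
  qed
  then obtain a b N T where s: "(a, b, N, T) \<in> R" "(u, v) \<in> A" "u \<in> T \<union> {a}" "v \<in> N \<union> {b}"
    by (rule stepE)
  have "u = a"
  proof (rule ccontr)
    assume "u \<noteq> a"
    then have u: "u \<in> T" using s by blast
    have "(a, v) \<in> A"
    proof (cases "v = b")
      case True
      then show ?thesis using rope_arc[OF s(1)] by simp
    next
      case False
      then show ?thesis using s(4) rope_support[OF s(1), of v] by blast
    qed
    then have "(a, v) \<in> ?F"
      using stepI[OF s(1)] s(4) by (auto simp: E_join_steps)
    then show False
      using rope_join(5)[OF s(1) u] cover[of a] by (auto simp: reorient_def)
  qed
  moreover have "v = b"
  proof (rule ccontr)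
    assume "v \<noteq> b"
    then have v: "v \<in> N" using s by blast
    have "(u, b) \<in> A"
      using \<open>u = a\<close> rope_arc[OF s(1)] by simp
    then have "(u, b) \<in> ?F"
      using stepI[OF s(1)] s(3) by (auto simp: E_join_steps)
    then show False
      using rope_join(3)[OF s(1) v] cover[of b] by (auto simp: reorient_def)
  qed
  ultimately show ?thesis using s(1) by blast
qed

lemma delta_join_E_join: "delta_join V A (E_join A R) = R"
proof -
  have "descent (E_join A R) u v \<longleftrightarrow> (\<exists>N T. (u, v, N, T) \<in> R)" for u v
    using rope_descent descent_E_join_rope by blast
  then have "delta_join V A (E_join A R) =
      {rope_of V A (E_join A R) u v | u v. \<exists>N T. (u, v, N, T) \<in> R}"
    by (simp add: delta_join_eq[OF E_join_acyclic_reorientation[OF R_ropes]])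
  also have "\<dots> = R"
  proof (intro equalityI subsetI)
    fix \<rho> assume "\<rho> \<in> R"
    moreover obtain u v N T where "\<rho> = (u, v, N, T)" by (cases \<rho>)
    ultimately have "(u, v, N, T) \<in> R" "\<rho> = rope_of V A (E_join A R) u v"
      using rope_of_E_join[of u v N T] by simp_all
    then show "\<rho> \<in> {rope_of V A (E_join A R) u v | u v. \<exists>N T. (u, v, N, T) \<in> R}" by blast
  next
    fix \<rho> assume "\<rho> \<in> {rope_of V A (E_join A R) u v | u v. \<exists>N T. (u, v, N, T) \<in> R}"
    then obtain u v N T where "\<rho> = rope_of V A (E_join A R) u v" "(u, v, N, T) \<in> R" by blast
    then show "\<rho> \<in> R" using rope_of_E_join[of u v N T] by simp
  qed
  finally show ?thesis .
qed

end

section \<open>Duality\<close>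

text \<open>The effect on ropes of complementing a reorientation: reversed and unreversed arcs
  change roles.\<close>

fun swap_rope :: "'a rope \<Rightarrow> 'a rope" where
  "swap_rope (u, v, N, T) = (u, v, T, N)"

lemma swap_rope_swap_rope [simp]: "swap_rope (swap_rope \<rho>) = \<rho>"
  by (cases \<rho>) simp

lemma swap_rope_image_image [simp]: "swap_rope ` swap_rope ` R = R"
  by (simp add: image_image)

lemma swap_rope_ropes: "\<rho> \<in> ropes A \<Longrightarrow> swap_rope \<rho> \<in> ropes A"
  by (cases \<rho>) (auto simp: ropes_def)

lemma crossing_swap_rope: "crossing (swap_rope \<rho>) (swap_rope \<sigma>) \<Longrightarrow> crossing \<rho> \<sigma>"
proof (cases \<rho>; cases \<sigma>)
  fix u v N T u' v' N' T'
  assume \<rho>: "\<rho> = (u, v, N, T)" and \<sigma>: "\<sigma> = (u', v', N', T')"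
    and "crossing (swap_rope \<rho>) (swap_rope \<sigma>)"
  then obtain w w' where "w \<noteq> w'" "w \<in> (T \<union> {u, v}) \<inter> (N' \<union> {u', v'})"
    "w' \<in> (N \<union> {u, v}) \<inter> (T' \<union> {u', v'})"
    unfolding \<rho> \<sigma> swap_rope.simps crossing.simps by blast
  then show "crossing \<rho> \<sigma>"
    unfolding \<rho> \<sigma> crossing.simps by (intro exI[of _ w'] exI[of _ w]) simp
qed

lemma swap_rope_noncrossing:
  assumes "R \<in> noncrossing_diagrams A"
  shows "swap_rope ` R \<in> noncrossing_diagrams A"
proof -
  have "\<not> crossing (swap_rope \<rho>) (swap_rope \<sigma>)" if "\<rho> \<in> R" "\<sigma> \<in> R" "\<rho> \<noteq> \<sigma>" for \<rho> \<sigma>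
    using assms that crossing_swap_rope[of \<rho> \<sigma>]
    by (auto simp: noncrossing_diagrams_def simp del: crossing.simps)
  then have "\<not> crossing \<rho> \<sigma>" if "\<rho> \<in> swap_rope ` R" "\<sigma> \<in> swap_rope ` R" "\<rho> \<noteq> \<sigma>" for \<rho> \<sigma>
    using that by blast
  moreover have "swap_rope \<rho> \<in> ropes A" if "\<rho> \<in> R" for \<rho>
    using assms that by (intro swap_rope_ropes) (auto simp: noncrossing_diagrams_def)
  then have "swap_rope ` R \<subseteq> ropes A" by blast
  ultimately show ?thesis by (simp add: noncrossing_diagrams_def del: crossing.simps)
qed

lemma I_meet_swap_rope: "I_meet A \<rho> = A - I_join A (swap_rope \<rho>)"
  by (cases \<rho>) auto

lemma transitive_reduction_converse:
  "transitive_reduction (G\<inverse>) = (transitive_reduction G)\<inverse>"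
proof -
  have rev: "dipath (H\<inverse>) (rev p)" if "dipath H p" for H :: "'a rel" and p
    using that by (simp add: dipath_def)
  have "(\<exists>p. dipath (G\<inverse>) p \<and> hd p = u \<and> last p = v \<and> 3 \<le> length p) \<longleftrightarrow>
      (\<exists>p. dipath G p \<and> hd p = v \<and> last p = u \<and> 3 \<le> length p)" for u v :: 'a
    using rev[of G] rev[of "G\<inverse>"] by (metis converse_converse hd_rev last_rev length_rev)
  then show ?thesis unfolding transitive_reduction_def by auto
qed

context skeletal_dag
begin

text \<open>\<open>A - E\<close> reorients \<open>A\<close> to the converse graph, so the unreversed
  arcs of one transitive reduction are the reversed arcs of the other.\<close>

lemma delta_meet_eq:
  assumes "E \<in> acyclic_reorientations A"
  shows "delta_meet V A E = swap_rope ` delta_join V A (A - E)"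
proof -
  have E: "E \<subseteq> A" using assms by (simp add: acyclic_reorientations_def)
  then have "reorient A (A - E) = (reorient A E)\<inverse>"
    by (auto simp: reorient_def)
  then have tr: "(v, u) \<in> transitive_reduction (reorient A (A - E)) \<longleftrightarrow>
      (u, v) \<in> transitive_reduction (reorient A E)" for u v
    by (simp add: transitive_reduction_converse)
  have swap: "rope_of V A E u v = swap_rope (rope_of V A (A - E) u v)" for u v
    using E by (auto simp: rope_of_def nabla_set_eq delta_set_eq)
  show ?thesis
    unfolding delta_meet_def delta_join_def tr swap by blast
qed

lemma E_meet_eq:
  assumes "R \<subseteq> ropes A"
  shows "E_meet A R = A - E_join A (swap_rope ` R)"
proof -
  have "I_meet A \<rho> \<in> acyclic_reorientations A" if "\<rho> \<in> R" for \<rho>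
    unfolding I_meet_swap_rope using assms that
    by (intro compl_acyclic_reorientations I_join_acyclic_reorientation swap_rope_ropes) blast
  then have "I_meet A ` R \<subseteq> acyclic_reorientations A" by blast
  moreover have "(\<lambda>E. A - E) ` I_meet A ` R = I_join A ` swap_rope ` R"
  proof -
    have "A - I_meet A \<rho> = I_join A (swap_rope \<rho>)" for \<rho>
      by (cases \<rho>) auto
    then show ?thesis by (simp add: image_image)
  qed
  ultimately show ?thesis
    by (simp add: E_meet_def E_join_def inf_AR_poset)
qed

end

theorem proposition29:
  fixes V :: "'a set" and A :: "'a rel"
  assumes "dag V A" and "skeletal V A"
  shows "(bij_betw (delta_join V A) (acyclic_reorientations A) (noncrossing_diagrams A) \<and>
          bij_betw (E_join A) (noncrossing_diagrams A) (acyclic_reorientations A) \<and>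
          (\<forall>E \<in> acyclic_reorientations A. E_join A (delta_join V A E) = E) \<and>
          (\<forall>R \<in> noncrossing_diagrams A. delta_join V A (E_join A R) = R)) \<and>
         (bij_betw (delta_meet V A) (acyclic_reorientations A) (noncrossing_diagrams A) \<and>
          bij_betw (E_meet A) (noncrossing_diagrams A) (acyclic_reorientations A) \<and>
          (\<forall>E \<in> acyclic_reorientations A. E_meet A (delta_meet V A E) = E) \<and>
          (\<forall>R \<in> noncrossing_diagrams A. delta_meet V A (E_meet A R) = R))"
proof -
  interpret skeletal_dag V A using assms by unfold_locales
  let ?AR = "acyclic_reorientations A" and ?NC = "noncrossing_diagrams A"
  have inverses: "bij_betw f ?AR ?NC \<and> bij_betw g ?NC ?AR \<and>
      (\<forall>E \<in> ?AR. g (f E) = E) \<and> (\<forall>R \<in> ?NC. f (g R) = R)"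
    if "\<And>E. E \<in> ?AR \<Longrightarrow> f E \<in> ?NC" "\<And>R. R \<in> ?NC \<Longrightarrow> g R \<in> ?AR"
      "\<And>E. E \<in> ?AR \<Longrightarrow> g (f E) = E" "\<And>R. R \<in> ?NC \<Longrightarrow> f (g R) = R" for f g
  proof -
    have "bij_betw f ?AR ?NC" by (rule bij_betw_byWitness[where f' = g]) (use that in auto)
    moreover have "bij_betw g ?NC ?AR" by (rule bij_betw_byWitness[where f' = f]) (use that in auto)
    ultimately show ?thesis using that by blast
  qed
  have NC: "R \<subseteq> ropes A" if "R \<in> ?NC" for R
    using that by (simp add: noncrossing_diagrams_def)
  have join: "delta_join V A (E_join A R) = R" if "R \<in> ?NC" for R
  proof -
    interpret noncrossing_diagram V A R using that by unfold_locales
    show ?thesis by (rule delta_join_E_join)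
  qed
  have compl: "A - (A - E) = E" if "E \<in> ?AR" for E
    using that by (auto simp: acyclic_reorientations_def)
  show ?thesis
  proof (intro conjI[OF inverses inverses])
    fix E assume E: "E \<in> ?AR"
    show "delta_join V A E \<in> ?NC" by (rule delta_join_noncrossing[OF E])
    show "E_join A (delta_join V A E) = E" by (rule E_join_delta_join[OF E])
    \<comment> \<open>The meet maps are the join maps conjugated by complementation and
      \<open>swap_rope\<close>, so the join half is applied to \<open>A - E\<close> here and to the
      swapped diagram below.\<close>
    have D: "delta_join V A (A - E) \<in> ?NC"
      by (intro delta_join_noncrossing compl_acyclic_reorientations E)
    then show M: "delta_meet V A E \<in> ?NC"
      unfolding delta_meet_eq[OF E] by (rule swap_rope_noncrossing)
    show "E_meet A (delta_meet V A E) = E"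
      unfolding E_meet_eq[OF NC[OF M]]
      by (simp add: delta_meet_eq[OF E] E_join_delta_join compl_acyclic_reorientations E compl)
  next
    fix R assume R: "R \<in> ?NC"
    show F: "E_join A R \<in> ?AR" by (rule E_join_acyclic_reorientation[OF NC[OF R]])
    show "delta_join V A (E_join A R) = R" by (rule join[OF R])
    have S: "swap_rope ` R \<in> ?NC" by (rule swap_rope_noncrossing[OF R])
    have F': "E_join A (swap_rope ` R) \<in> ?AR" by (rule E_join_acyclic_reorientation[OF NC[OF S]])
    then show "E_meet A R \<in> ?AR"
      unfolding E_meet_eq[OF NC[OF R]] by (rule compl_acyclic_reorientations)
    then show "delta_meet V A (E_meet A R) = R"
      by (simp add: delta_meet_eq E_meet_eq[OF NC[OF R]] compl[OF F'] join[OF S])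
  qed
qed

end
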